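(* Let $M\in\mathbb{R}^{n_1\times n_2}$, let $\Omega\subseteq\{1,\dots,n_1\}\times\{1,\dots,n_2\}$, and fix $\tau>0$. Let $\{\delta_k\}_{k\ge1}$ be a sequence of step sizes obeying $0<\inf_k\delta_k\le\sup_k\delta_k<2$. Starting with $Y^0=0\in\mathbb{R}^{n_1\times n_2}$, define inductively for $k=1,2,\ldots$ $$X^k = \mathcal{D}_\tau(Y^{k-1}),\qquad Y^k = Y^{k-1}+\delta_k\,\mathcal{P}_\Omega(M-X^k).$$ Then the sequence $\{X^k\}$ converges to the unique solution of $$\text{minimize } \ \tau\|X\|_*+\tfrac12\|X\|_F^2\quad\text{subject to } \mathcal{P}_\Omega(X)=\mathcal{P}_\Omega(M),$$ with optimization variable $X\in\mathbb{R}^{n_1\times n_2}$.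
   Context: For a matrix $X\in\mathbb{R}^{n_1\times n_2}$, $\|X\|_*$ denotes the nuclear norm (the sum of the singular values) and $\|X\|_F$ the Frobenius norm. $\mathcal{P}_\Omega$ is the orthogonal projector onto the space of matrices vanishing outside of $\Omega$: the $(i,j)$th entry of $\mathcal{P}_\Omega(X)$ equals $X_{ij}$ if $(i,j)\in\Omega$ and zero otherwise. Singular value shrinkage operator: if $X$ has rank $r$ and reduced singular value decomposition $X=U\Sigma V^*$, with $U$ ($n_1\times r$) and $V$ ($n_2\times r$) having orthonormal columns and $\Sigma=\mathrm{diag}(\{\sigma_i\}_{1\le i\le r})$, $\sigma_i>0$, then $\mathcal{D}_\tau(X):=U\,\mathrm{diag}(\{(\sigma_i-\tau)_+\}_{1\le i\le r})\,V^*$, where $t_+=\max(0,t)$. *)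

theory Defs
  imports "HOL-Analysis.Analysis"
begin

text \<open>
  An \<open>n1 \<times> n2\<close> real matrix is an element of \<^typ>\<open>real ^ 'n2 ^ 'n1\<close>. The library norm of this
  type is the Frobenius norm:
\<close>

lemma norm_matrix_eq_frobenius:
  fixes X :: "real ^ 'n2 ^ 'n1"
  shows "norm X = sqrt (\<Sum>i\<in>UNIV. \<Sum>j\<in>UNIV. (X $ i $ j)\<^sup>2)"
  by (simp add: norm_vec_def L2_set_def sum_nonneg)

definition orthonormal_family :: "nat \<Rightarrow> (nat \<Rightarrow> real ^ 'n) \<Rightarrow> bool" where
  "orthonormal_family r u \<longleftrightarrow>
     (\<forall>k<r. \<forall>l<r. u k \<bullet> u l = (if k = l then 1 else 0))"

text \<open>
  The size \<open>r\<close> of the factors of a reduced singular value decomposition varies with the matrix,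
  so \<open>U\<close> and \<open>V\<close> are given by their columns \<open>u k\<close>, \<open>v k\<close> for \<open>k < r\<close>, and
  \<open>usv_matrix r u s v\<close> is the product \<open>U diag(s) V\<^sup>*\<close>, written out entrywise.
\<close>

definition usv_matrix ::
  "nat \<Rightarrow> (nat \<Rightarrow> real ^ 'n1) \<Rightarrow> (nat \<Rightarrow> real) \<Rightarrow> (nat \<Rightarrow> real ^ 'n2) \<Rightarrow> real ^ 'n2 ^ 'n1" where
  "usv_matrix r u s v = (\<chi> i j. \<Sum>k<r. u k $ i * s k * v k $ j)"

definition reduced_svd ::
  "real ^ 'n2 ^ 'n1 \<Rightarrow> (nat \<Rightarrow> real ^ 'n1) \<Rightarrow> (nat \<Rightarrow> real) \<Rightarrow> (nat \<Rightarrow> real ^ 'n2) \<Rightarrow> bool" where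
  "reduced_svd X u s v \<longleftrightarrow>
     orthonormal_family (rank X) u \<and> orthonormal_family (rank X) v \<and>
     (\<forall>k<rank X. s k > 0) \<and> X = usv_matrix (rank X) u s v"

text \<open>
  Every matrix has a reduced singular value decomposition, and neither the sum of the singular
  values nor the shrunk matrix depends on which one is taken, so both descriptions below are
  proper.
\<close>

definition nuclear_norm :: "real ^ 'n2 ^ 'n1 \<Rightarrow> real" where
  "nuclear_norm X = (THE t. \<exists>u s v. reduced_svd X u s v \<and> t = (\<Sum>k<rank X. s k))"

definition sv_shrink :: "real \<Rightarrow> real ^ 'n2 ^ 'n1 \<Rightarrow> real ^ 'n2 ^ 'n1" where
  "sv_shrink \<tau> X =
     (THE Z. \<exists>u s v. reduced_svd X u s v \<and> Z = usv_matrix (rank X) u (\<lambda>k. max 0 (s k - \<tau>)) v)"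

definition proj_on :: "('n1 \<times> 'n2) set \<Rightarrow> real ^ 'n2 ^ 'n1 \<Rightarrow> real ^ 'n2 ^ 'n1" where
  "proj_on \<Omega> X = (\<chi> i j. if (i, j) \<in> \<Omega> then X $ i $ j else 0)"

end

theory Submission
  imports Defs
begin

text \<open>
  Write \<open>f W = \<tau> * nuclear_norm W + 1/2 * (norm W)\<^sup>2\<close>. Everything rests on
  one inequality about singular value shrinkage: with \<open>D = sv_shrink \<tau>\<close>, the
  residual \<open>Y - D Y\<close> is a subgradient of \<open>\<tau> * nuclear_norm\<close> at
  \<open>D Y\<close>. This makes \<open>D Y\<close> the unique minimizer of \<open>f W - Y \<bullet>
  W\<close>, and the iteration is then Uzawa's method: gradient ascent for the Lagrange dual of the
  constrained problem, the dual variable being the matrix \<open>Y\<close> supported on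
  \<open>\<Omega>\<close>.

  The subgradient inequality comes from the singular value decomposition. If \<open>Y\<close> has
  singular values \<open>s k\<close>, then \<open>Y - D Y\<close> has the same singular vectors with
  values \<open>min \<tau> (s k) \<le> \<tau>\<close>, so it pairs with any \<open>W\<close> to at
  most \<open>\<tau> * nuclear_norm W\<close> (lemma \<open>trace_duality\<close>, a consequence of
  Bessel's inequality), and it pairs with \<open>D Y\<close> to exactly \<open>\<tau> * nuclear_norm
  (D Y)\<close>. The same duality shows that the nuclear norm and the shrunk matrix are independent
  of the decomposition.

  The rest is an argument about a map \<open>D\<close> with this inequality on an abstract Euclidean
  space. Two instances of it added together give that \<open>D\<close> is firmly nonexpansive. A
  dual solution \<open>Y\<^sup>*\<close> exists by compactness: the conjugate of \<open>f\<close> is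
  continuous, and it grows at least linearly, even after a linear functional is subtracted, because
  \<open>f\<close> is bounded on balls; the conjugate has gradient \<open>D\<close>, so its
  minimizer satisfies the constraint. Then \<open>D Y\<^sup>*\<close> is the unique solution.
  Finally, firm nonexpansiveness gives \<open>(norm (Y k - Y\<^sup>*))\<^sup>2 \<le> (norm (Y (k-1)
  - Y\<^sup>*))\<^sup>2 - \<delta> k * (2 - \<delta> k) * (norm (X k - D
  Y\<^sup>*))\<^sup>2\<close>. Since \<open>\<delta> k * (2 - \<delta> k)\<close> is bounded away
  from 0, the errors \<open>(norm (X k - D Y\<^sup>*))\<^sup>2\<close> are summable, hence tend to
  0.
\<close>

section \<open>Proximal maps\<close>

lemma inner_sgn_self: "x \<bullet> sgn x = norm x"
proof -
  have "x \<bullet> sgn x = inverse (norm x) * (norm x)\<^sup>2"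
    unfolding sgn_div_norm inner_scaleR_right power2_norm_eq_inner by (rule refl)
  then show ?thesis
    by (cases "x = 0") (simp_all add: power2_eq_square)
qed

text \<open>
  \<open>Y - D Y\<close> is a subgradient of \<open>g\<close> at \<open>D Y\<close>; for convex
  \<open>g\<close> this characterizes \<open>D\<close> as the proximal map of \<open>g\<close>. The
  inequality is taken as the definition because it carries all the convexity of \<open>g\<close>
  that the convergence proof uses.
\<close>

definition is_prox :: "('a::real_inner \<Rightarrow> real) \<Rightarrow> ('a \<Rightarrow> 'a) \<Rightarrow> bool" where
  "is_prox g D \<longleftrightarrow> (\<forall>Y W. g (D Y) + (Y - D Y) \<bullet> (W - D Y) \<le> g W)"

lemma is_proxD: "is_prox g D \<Longrightarrow> g (D Y) + (Y - D Y) \<bullet> (W - D Y) \<le> g W"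
  by (simp add: is_prox_def)

text \<open>
  Each of the two points is a competitor in the subgradient inequality of the other; adding both
  inequalities cancels the values of \<open>g\<close>.
\<close>

lemma prox_firmly_nonexpansive:
  assumes "is_prox g D"
  shows "(norm (D Y - D Y'))\<^sup>2 \<le> (D Y - D Y') \<bullet> (Y - Y')"
  using is_proxD[OF assms, of Y "D Y'"] is_proxD[OF assms, of Y' "D Y"]
  unfolding power2_norm_eq_inner by (simp add: algebra_simps inner_commute)

lemma prox_nonexpansive:
  assumes "is_prox g D"
  shows "norm (D Y - D Y') \<le> norm (Y - Y')"
proof -
  have "norm (D Y - D Y') * norm (D Y - D Y') \<le> norm (D Y - D Y') * norm (Y - Y')"
    using prox_firmly_nonexpansive[OF assms, of Y Y'] norm_cauchy_schwarz[of "D Y - D Y'" "Y - Y'"]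
    by (simp add: power2_eq_square)
  then show ?thesis
    by (cases "D Y = D Y'") auto
qed

text \<open>
  The subgradient inequality combined with the expansion of the square around \<open>D Y\<close>:
  adding \<open>1/2 * (norm W)\<^sup>2\<close> turns the subgradient \<open>Y - D Y\<close> of
  \<open>g\<close> into the subgradient \<open>Y\<close> and leaves a quadratic gap, the source of
  uniqueness.
\<close>

lemma prox_strong_minimality:
  assumes "is_prox g D"
  shows "g (D Y) + 1/2 * (norm (D Y))\<^sup>2 + Y \<bullet> (W - D Y) + 1/2 * (norm (W - D Y))\<^sup>2
         \<le> g W + 1/2 * (norm W)\<^sup>2"
  using is_proxD[OF assms, of Y W]
  unfolding power2_norm_eq_inner by (simp add: algebra_simps inner_commute)

text \<open>
  The convex conjugate of \<open>g W + 1/2 * (norm W)\<^sup>2\<close>, evaluated through its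
  maximizer \<open>D Y\<close> so that no supremum appears; lemma \<open>fenchel_young\<close> says
  that it is the maximum.
\<close>

definition dual_fun :: "('a::real_inner \<Rightarrow> real) \<Rightarrow> ('a \<Rightarrow> 'a) \<Rightarrow> 'a \<Rightarrow> real" where
  "dual_fun g D Y = Y \<bullet> D Y - (g (D Y) + 1/2 * (norm (D Y))\<^sup>2)"

lemma fenchel_young:
  assumes "is_prox g D"
  shows "Y \<bullet> W - (g W + 1/2 * (norm W)\<^sup>2) \<le> dual_fun g D Y"
  using prox_strong_minimality[OF assms, of Y W] zero_le_power2[of "norm (W - D Y)"]
  unfolding dual_fun_def inner_diff_right by linarith

text \<open>
  \<open>D Y\<close> is a subgradient of the conjugate at \<open>Y\<close>. Exchanging the two
  points bounds the same increment from above; as \<open>D\<close> is continuous, the two bounds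
  stand in for the statement that the gradient of the conjugate is \<open>D\<close>.
\<close>

lemma dual_fun_lower:
  assumes "is_prox g D"
  shows "(Y' - Y) \<bullet> D Y \<le> dual_fun g D Y' - dual_fun g D Y"
  using fenchel_young[OF assms, of Y' "D Y"]
  by (simp add: dual_fun_def inner_diff_left)

lemma dual_fun_upper:
  assumes "is_prox g D"
  shows "dual_fun g D Y' - dual_fun g D Y \<le> (Y' - Y) \<bullet> D Y'"
  using dual_fun_lower[OF assms, of Y Y'] by (simp add: inner_diff_left)

lemma continuous_on_dual_fun:
  assumes "is_prox g D"
  shows "continuous_on A (dual_fun g D)"
proof -
  have D: "isCont D Y" for Y
    unfolding continuous_at_eps_delta
    using prox_nonexpansive[OF assms] by (auto simp: dist_norm intro: order_le_less_trans)
  have "isCont (dual_fun g D) Y" for Y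
  proof -
    have lower: "((\<lambda>Y'. (Y' - Y) \<bullet> D Y) \<longlongrightarrow> (Y - Y) \<bullet> D Y) (at Y)"
      by (intro tendsto_intros)
    have upper: "((\<lambda>Y'. (Y' - Y) \<bullet> D Y') \<longlongrightarrow> (Y - Y) \<bullet> D Y) (at Y)"
      using D[of Y] unfolding isCont_def by (intro tendsto_intros)
    have "((\<lambda>Y'. dual_fun g D Y' - dual_fun g D Y) \<longlongrightarrow> (Y - Y) \<bullet> D Y) (at Y)"
      by (rule tendsto_sandwich[OF _ _ lower upper]; rule always_eventually)
         (use dual_fun_lower[OF assms] dual_fun_upper[OF assms] in blast)+
    then show ?thesis
      unfolding isCont_def by (simp add: LIM_zero_iff)
  qed
  then show ?thesis
    by (simp add: continuous_at_imp_continuous_on)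
qed

definition orthogonal_projection :: "('a::real_inner \<Rightarrow> 'a) \<Rightarrow> bool" where
  "orthogonal_projection P \<longleftrightarrow>
     linear P \<and> (\<forall>x. P (P x) = P x) \<and> (\<forall>x y. P x \<bullet> y = x \<bullet> P y)"

lemma norm_orthogonal_projection_le:
  assumes "orthogonal_projection P"
  shows "norm (P x) \<le> norm x"
proof -
  have "P x \<bullet> P x = x \<bullet> P x"
    using assms by (metis orthogonal_projection_def)
  then have "norm (P x) * norm (P x) \<le> norm x * norm (P x)"
    using norm_cauchy_schwarz[of x "P x"] by (simp add: dot_square_norm power2_eq_square)
  then show ?thesis
    by (cases "P x = 0") auto
qed

section \<open>The dual problem\<close>

text \<open>
  Boundedness of \<open>g\<close> on a ball around \<open>M\<close> makes the conjugate outgrow the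
  functional \<open>Y \<bullet> M\<close> linearly, so a minimizer over the range of
  \<open>P\<close> can be sought in a compact ball.
\<close>

lemma dual_minimizer_exists:
  fixes D :: "'a::euclidean_space \<Rightarrow> 'a"
  assumes prox: "is_prox g D" and P: "orthogonal_projection P"
    and bdd: "\<And>W. norm (W - M) \<le> 1 \<Longrightarrow> g W \<le> B"
  obtains Y where "P Y = Y" "\<And>Y'. P Y' = Y' \<Longrightarrow> dual_fun g D Y - Y \<bullet> M \<le> dual_fun g D Y' - Y' \<bullet> M"
proof -
  define h where "h Y = dual_fun g D Y - Y \<bullet> M" for Y
  define C where "C = B + 1/2 * (norm M + 1)\<^sup>2"
  have coercive: "norm Y - C \<le> h Y" for Y
  proof -
    \<comment> \<open>Test the conjugate at the point of the unit ball around \<open>M\<close> that lies in the direction of \<open>Y\<close>.\<close>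
    define W where "W = M + sgn Y"
    have WM: "norm (W - M) \<le> 1"
      by (simp add: W_def norm_sgn)
    then have "norm W \<le> norm M + 1"
      using norm_triangle_ineq[of M "W - M"] by simp
    then have "(norm W)\<^sup>2 \<le> (norm M + 1)\<^sup>2"
      by (intro power_mono) auto
    then have "g W + 1/2 * (norm W)\<^sup>2 \<le> C"
      using bdd[OF WM] unfolding C_def by linarith
    moreover have "Y \<bullet> W = Y \<bullet> M + norm Y"
      by (simp add: W_def inner_add_right inner_sgn_self)
    ultimately show ?thesis
      using fenchel_young[OF prox, of Y W] by (simp add: h_def)
  qed
  have lin: "linear P"
    using P by (simp add: orthogonal_projection_def)
  define K where "K = {Y. P Y = Y} \<inter> cball 0 (h 0 + C)"
  have "closed {Y. P Y = Y}"
    using lin by (intro closed_Collect_eq linear_continuous_on continuous_intros)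
                 (simp add: linear_conv_bounded_linear)
  then have "compact K"
    unfolding K_def by (simp add: closed_Int_compact)
  moreover have "0 \<in> K"
    using coercive[of 0] lin by (simp add: K_def linear_0)
  moreover have "continuous_on K h"
    unfolding h_def by (intro continuous_intros continuous_on_dual_fun[OF prox])
  ultimately obtain Y where Y: "Y \<in> K" "\<And>Y'. Y' \<in> K \<Longrightarrow> h Y \<le> h Y'"
    using continuous_attains_inf[of K h] by auto
  have "h Y \<le> h Y'" if "P Y' = Y'" for Y'
  proof (cases "Y' \<in> K")
    case False
    then have "h 0 \<le> h Y'"
      using that coercive[of Y'] by (auto simp: K_def)
    then show ?thesis
      using Y(2)[OF \<open>0 \<in> K\<close>] by simp
  qed (use Y in auto)
  with Y show thesis
    by (intro that[of Y]) (auto simp: K_def h_def)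
qed

text \<open>
  The gradient of the dual objective at \<open>Y\<close> is \<open>D Y - M\<close>, and stationarity
  over the range of \<open>P\<close> says that its projection vanishes. Because \<open>D\<close> is
  1-Lipschitz, a single step of length \<open>1/2\<close> along the projected negative gradient
  already shows this without a limit: it lowers the objective by at least a quarter of the squared
  norm of that projection.
\<close>

lemma dual_minimizer_feasible:
  assumes prox: "is_prox g D" and P: "orthogonal_projection P"
    and Y: "P Y = Y"
    and min: "\<And>Y'. P Y' = Y' \<Longrightarrow> dual_fun g D Y - Y \<bullet> M \<le> dual_fun g D Y' - Y' \<bullet> M"
  shows "P (D Y) = P M"
proof -
  have lin: "linear P" and idem: "P (P x) = P x" and adj: "P x \<bullet> y = x \<bullet> P y" for x y
    using P by (simp_all add: orthogonal_projection_def)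
  define G where "G = P (M - D Y)"
  define Y' where "Y' = Y + (1/2) *\<^sub>R G"
  have diff: "Y' - Y = (1/2) *\<^sub>R G"
    by (simp add: Y'_def)
  have "P Y' = Y'"
    by (simp add: Y'_def G_def linear_add[OF lin] linear_scale[OF lin] Y idem)
  from min[OF this] have "(Y' - Y) \<bullet> M \<le> (Y' - Y) \<bullet> D Y'"
    using dual_fun_upper[OF prox, of Y' Y] by (simp add: inner_diff_left)
  then have "0 \<le> G \<bullet> (D Y' - M)"
    by (simp add: diff inner_diff_right)
  also have "\<dots> = G \<bullet> (D Y' - D Y) - G \<bullet> (M - D Y)"
    by (simp add: inner_diff_right)
  also have "G \<bullet> (M - D Y) = (norm G)\<^sup>2"
    unfolding power2_norm_eq_inner by (metis G_def adj idem)
  also have "G \<bullet> (D Y' - D Y) \<le> norm G * norm (Y' - Y)"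
    using norm_cauchy_schwarz[of G "D Y' - D Y"] prox_nonexpansive[OF prox, of Y' Y]
    by (meson mult_left_mono norm_ge_zero order_trans)
  also have "norm G * norm (Y' - Y) = (norm G)\<^sup>2 / 2"
    by (simp add: diff power2_eq_square)
  finally have "G = 0"
    by simp
  then show ?thesis
    by (simp add: G_def linear_diff[OF lin])
qed

text \<open>
  The multiplier \<open>Y\<close> lies in the range of \<open>P\<close>, hence is orthogonal to the
  difference of two feasible points; the linear term of lemma \<open>prox_strong_minimality\<close>
  disappears and the quadratic gap remains.
\<close>

lemma saddle_point_unique_minimizer:
  assumes prox: "is_prox g D" and P: "orthogonal_projection P"
    and Y: "P Y = Y" "P (D Y) = P M"
    and W: "P W = P M" "W \<noteq> D Y"
  shows "g (D Y) + 1/2 * (norm (D Y))\<^sup>2 < g W + 1/2 * (norm W)\<^sup>2"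
proof -
  have "Y \<bullet> (W - D Y) = Y \<bullet> P (W - D Y)"
    using P Y(1) by (metis orthogonal_projection_def)
  also have "P (W - D Y) = 0"
    using P Y(2) W(1) by (simp add: orthogonal_projection_def linear_diff)
  finally have "Y \<bullet> (W - D Y) = 0"
    by simp
  moreover have "0 < (norm (W - D Y))\<^sup>2"
    using W(2) by simp
  ultimately show ?thesis
    using prox_strong_minimality[OF prox, of Y W] by linarith
qed

section \<open>Convergence of the dual ascent\<close>

text \<open>
  In the expansion of the square, the cross term is at most \<open>- 2 * d * (norm (D Z - D
  Y))\<^sup>2\<close> by firm nonexpansiveness (the projection may be dropped there, as \<open>Z -
  Y\<close> lies in its range), and the quadratic term is at most \<open>d\<^sup>2 * (norm (D Z - D
  Y))\<^sup>2\<close>.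
\<close>

lemma uzawa_step:
  assumes prox: "is_prox g D" and P: "orthogonal_projection P"
    and Y: "P Y = Y" "P (D Y) = P M" and Z: "P Z = Z" and "0 \<le> d"
  shows "(norm (Z + d *\<^sub>R P (M - D Z) - Y))\<^sup>2
         \<le> (norm (Z - Y))\<^sup>2 - d * (2 - d) * (norm (D Z - D Y))\<^sup>2"
proof -
  have lin: "linear P" and adj: "P x \<bullet> y = x \<bullet> P y" for x y
    using P by (simp_all add: orthogonal_projection_def)
  define E where "E = D Y - D Z"
  have PM: "P (M - D Z) = P E"
    by (simp add: E_def linear_diff[OF lin] Y)
  have "P E \<bullet> (Z - Y) = E \<bullet> (Z - Y)"
    by (simp add: adj linear_diff[OF lin] Y Z)
  also have "\<dots> \<le> - (norm E)\<^sup>2"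
    using prox_firmly_nonexpansive[OF prox, of Y Z] by (simp add: E_def inner_diff_right)
  finally have 1: "2 * d * (P E \<bullet> (Z - Y)) \<le> 2 * d * (- (norm E)\<^sup>2)"
    using \<open>0 \<le> d\<close> by (intro mult_left_mono) auto
  have 2: "d\<^sup>2 * (norm (P E))\<^sup>2 \<le> d\<^sup>2 * (norm E)\<^sup>2"
    by (intro mult_left_mono power_mono norm_orthogonal_projection_le[OF P]) auto
  have "(norm (Z + d *\<^sub>R P E - Y))\<^sup>2
      = (norm (Z - Y))\<^sup>2 + 2 * d * (P E \<bullet> (Z - Y)) + d\<^sup>2 * (norm (P E))\<^sup>2"
    unfolding power2_norm_eq_inner
    by (simp add: algebra_simps inner_commute power2_eq_square)
  also have "\<dots> \<le> (norm (Z - Y))\<^sup>2 - d * (2 - d) * (norm E)\<^sup>2"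
    using 1 2 by (simp add: algebra_simps power2_eq_square)
  finally show ?thesis
    by (simp add: PM E_def norm_minus_commute)
qed

lemma tendsto_0_of_telescoping_bound:
  fixes a b :: "nat \<Rightarrow> real"
  assumes "\<And>k. 0 \<le> a k" "\<And>k. 0 \<le> b k" "0 < c" "\<And>k. a (Suc k) \<le> a k - c * b k"
  shows "b \<longlonglongrightarrow> 0"
proof -
  have *: "c * (\<Sum>k<n. b k) \<le> a 0 - a n" for n
  proof (induction n)
    case (Suc n)
    then show ?case
      using assms(4)[of n] by (simp add: algebra_simps)
  qed simp
  have "(\<Sum>k<n. b k) \<le> a 0 / c" for n
    using *[of n] assms(1)[of n] \<open>0 < c\<close> by (simp add: field_simps)
  then have "summable b"
    using assms(2) by (intro summableI_nonneg_bounded) auto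
  then show ?thesis
    by (rule summable_LIMSEQ_zero)
qed

lemma uzawa_convergence:
  assumes prox: "is_prox g D" and P: "orthogonal_projection P"
    and Ystar: "P Ystar = Ystar" "P (D Ystar) = P M"
    and step: "0 < a" "b < 2" "\<And>k. k \<ge> 1 \<Longrightarrow> a \<le> d k" "\<And>k. k \<ge> 1 \<Longrightarrow> d k \<le> b"
    and Y0: "Y 0 = 0"
    and Xk: "\<And>k. k \<ge> 1 \<Longrightarrow> X k = D (Y (k - 1))"
    and Yk: "\<And>k. k \<ge> 1 \<Longrightarrow> Y k = Y (k - 1) + d k *\<^sub>R P (M - X k)"
  shows "X \<longlonglongrightarrow> D Ystar"
proof -
  have lin: "linear P" and idem: "P (P x) = P x" for x
    using P by (simp_all add: orthogonal_projection_def)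
  have YSuc: "Y (Suc k) = Y k + d (Suc k) *\<^sub>R P (M - D (Y k))" for k
    using Xk[of "Suc k"] Yk[of "Suc k"] by simp
  have PY: "P (Y k) = Y k" for k
    by (induction k) (simp_all add: Y0 YSuc linear_0[OF lin] linear_add[OF lin] linear_scale[OF lin] idem)
  have dec: "(norm (Y (Suc k) - Ystar))\<^sup>2
      \<le> (norm (Y k - Ystar))\<^sup>2 - a * (2 - b) * (norm (D (Y k) - D Ystar))\<^sup>2" for k
  proof -
    have d: "a \<le> d (Suc k)" "d (Suc k) \<le> b"
      using step by auto
    then have "0 \<le> d (Suc k)" "a * (2 - b) \<le> d (Suc k) * (2 - d (Suc k))"
      using step(1,2) by (auto intro!: mult_mono)
    from this(2) have "a * (2 - b) * (norm (D (Y k) - D Ystar))\<^sup>2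
        \<le> d (Suc k) * (2 - d (Suc k)) * (norm (D (Y k) - D Ystar))\<^sup>2"
      by (intro mult_right_mono) auto
    with uzawa_step[OF prox P Ystar PY[of k] \<open>0 \<le> d (Suc k)\<close>] show ?thesis
      by (simp add: YSuc)
  qed
  have "(\<lambda>k. (norm (D (Y k) - D Ystar))\<^sup>2) \<longlonglongrightarrow> 0"
    using step dec
    by (intro tendsto_0_of_telescoping_bound[where a="\<lambda>k. (norm (Y k - Ystar))\<^sup>2" and c="a * (2 - b)"]) auto
  then have "(\<lambda>k. norm (X (Suc k) - D Ystar)) \<longlonglongrightarrow> 0"
    using Xk by (simp add: power_tendsto_0_iff)
  then show ?thesis
    by (rule LIMSEQ_imp_Suc[OF LIM_zero_cancel[OF tendsto_norm_zero_cancel]])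
qed

section \<open>Orthonormal families and singular vectors\<close>

lemma inner_orthonormal_sum:
  assumes "orthonormal_family r u" "k < r"
  shows "u k \<bullet> (\<Sum>l<r. c l *\<^sub>R u l) = c k"
proof -
  have "u k \<bullet> (\<Sum>l<r. c l *\<^sub>R u l) = (\<Sum>l<r. if l = k then c l else 0)"
    unfolding inner_sum_right using assms by (intro sum.cong) (auto simp: orthonormal_family_def)
  also have "\<dots> = c k"
    using assms by simp
  finally show ?thesis .
qed

lemma bessel_inequality:
  assumes "orthonormal_family r u"
  shows "(\<Sum>k<r. (u k \<bullet> x)\<^sup>2) \<le> (norm x)\<^sup>2"
proof -
  define p where "p = (\<Sum>k<r. (u k \<bullet> x) *\<^sub>R u k)"
  have p: "p \<bullet> y = (\<Sum>k<r. (u k \<bullet> x) * (u k \<bullet> y))" for y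
    by (simp add: p_def inner_sum_left)
  have "p \<bullet> p = (\<Sum>k<r. (u k \<bullet> x)\<^sup>2)"
    unfolding p using inner_orthonormal_sum[OF assms, folded p_def]
    by (simp add: p_def power2_eq_square inner_orthonormal_sum[OF assms])
  moreover have "p \<bullet> x = (\<Sum>k<r. (u k \<bullet> x)\<^sup>2)"
    by (simp add: p power2_eq_square)
  moreover have "0 \<le> (x - p) \<bullet> (x - p)"
    by simp
  ultimately show ?thesis
    unfolding power2_norm_eq_inner by (simp add: inner_diff_left inner_diff_right inner_commute)
qed

lemma orthonormal_family_independent:
  assumes "orthonormal_family r u"
  shows "inj_on u {..<r}" "independent (u ` {..<r})"
proof -
  show "inj_on u {..<r}"
  proof (rule inj_onI)
    fix k l assume kl: "k \<in> {..<r}" "l \<in> {..<r}" "u k = u l"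
    then have "u k \<bullet> u k = u k \<bullet> u l"
      by simp
    with assms kl(1,2) show "k = l"
      unfolding orthonormal_family_def by (metis lessThan_iff zero_neq_one)
  qed
  have "pairwise orthogonal (u ` {..<r})"
    using assms by (auto simp: pairwise_def orthogonal_def orthonormal_family_def)
  moreover have "0 \<notin> u ` {..<r}"
    using assms by (force simp: orthonormal_family_def)
  ultimately show "independent (u ` {..<r})"
    by (rule pairwise_orthogonal_independent)
qed

lemma orthonormal_family_le_card:
  fixes u :: "nat \<Rightarrow> real ^ 'n"
  assumes "orthonormal_family r u"
  shows "r \<le> CARD('n)"
  using orthonormal_family_independent[OF assms] independent_card_le[of "u ` {..<r}"]
  by (simp add: card_image)

lemma orthonormal_family_reindex:
  assumes "orthonormal_family r u" "inj_on p {..<m}" "p ` {..<m} \<subseteq> {..<r}"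
  shows "orthonormal_family m (u \<circ> p)"
  using assms unfolding orthonormal_family_def inj_on_def image_subset_iff by auto

lemma orthonormal_family_Suc:
  assumes "orthonormal_family n u" "norm x = 1" "\<And>k. k < n \<Longrightarrow> u k \<bullet> x = 0"
  shows "orthonormal_family (Suc n) (u(n := x))"
  using assms by (auto simp: orthonormal_family_def less_Suc_eq inner_commute norm_eq_1)

lemma usv_matrix_mult_vec:
  "usv_matrix r u s v *v x = (\<Sum>k<r. (s k * (v k \<bullet> x)) *\<^sub>R u k)"
proof -
  have "(\<Sum>j\<in>UNIV. (\<Sum>k<r. u k $ i * s k * v k $ j) * x $ j)
      = (\<Sum>k<r. s k * (\<Sum>j\<in>UNIV. v k $ j * x $ j) * u k $ i)" for i
    unfolding sum_distrib_left sum_distrib_right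
    by (subst sum.swap) (simp add: mult_ac)
  then show ?thesis
    by (simp add: vec_eq_iff usv_matrix_def matrix_vector_mult_def inner_vec_def)
qed

lemma vec_mult_usv_matrix:
  "x v* usv_matrix r u s v = (\<Sum>k<r. (s k * (u k \<bullet> x)) *\<^sub>R v k)"
proof -
  have "(\<Sum>i\<in>UNIV. x $ i * (\<Sum>k<r. u k $ i * s k * v k $ j))
      = (\<Sum>k<r. s k * (\<Sum>i\<in>UNIV. u k $ i * x $ i) * v k $ j)" for j
    unfolding sum_distrib_left sum_distrib_right
    by (subst sum.swap) (simp add: mult_ac)
  then show ?thesis
    by (simp add: vec_eq_iff usv_matrix_def vector_matrix_mult_def inner_vec_def)
qed

text \<open>
  The Frobenius pairing with \<open>U diag(s) V\<^sup>*\<close> is the trace of \<open>diag(s)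
  U\<^sup>* W V\<close>, and so is linear in the singular values with coefficients \<open>u k
  \<bullet> (W *v v k)\<close>.
\<close>

lemma inner_usv_matrix:
  "W \<bullet> usv_matrix r u s v = (\<Sum>k<r. s k * (u k \<bullet> (W *v v k)))"
proof -
  have "W \<bullet> usv_matrix r u s v
      = (\<Sum>i\<in>UNIV. \<Sum>j\<in>UNIV. \<Sum>k<r. s k * (u k $ i * (W $ i $ j * v k $ j)))"
    by (simp add: inner_vec_def usv_matrix_def sum_distrib_left mult_ac)
  also have "\<dots> = (\<Sum>k<r. \<Sum>i\<in>UNIV. \<Sum>j\<in>UNIV. s k * (u k $ i * (W $ i $ j * v k $ j)))"
    by (simp add: sum.swap[where B="{..<r}"])
  also have "\<dots> = (\<Sum>k<r. s k * (u k \<bullet> (W *v v k)))"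
    by (simp add: inner_vec_def matrix_vector_mult_def sum_distrib_left)
  finally show ?thesis .
qed

lemma usv_matrix_mult_right_singular:
  assumes "orthonormal_family r v" "k < r"
  shows "usv_matrix r u s v *v v k = s k *\<^sub>R u k"
proof -
  have "usv_matrix r u s v *v v k = (\<Sum>l<r. if l = k then s l *\<^sub>R u l else 0)"
    unfolding usv_matrix_mult_vec
    using assms by (intro sum.cong) (auto simp: orthonormal_family_def)
  then show ?thesis
    using assms by simp
qed

lemma usv_matrix_mult_left_singular:
  assumes "orthonormal_family r u" "k < r"
  shows "u k v* usv_matrix r u s v = s k *\<^sub>R v k"
proof -
  have "u k v* usv_matrix r u s v = (\<Sum>l<r. if l = k then s l *\<^sub>R v l else 0)"
    unfolding vec_mult_usv_matrix
    using assms by (intro sum.cong) (auto simp: orthonormal_family_def)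
  then show ?thesis
    using assms by simp
qed

lemma inner_usv_matrix_same:
  assumes "orthonormal_family r u" "orthonormal_family r v"
  shows "usv_matrix r u s v \<bullet> usv_matrix r u t v = (\<Sum>k<r. s k * t k)"
  unfolding inner_usv_matrix using assms
  by (intro sum.cong) (auto simp: usv_matrix_mult_right_singular orthonormal_family_def)

section \<open>Existence of the singular value decomposition\<close>

text \<open>
  A maximizer of the bilinear form \<open>x \<bullet> (R *v y)\<close> over the product of the unit
  balls is a pair of singular vectors for the operator norm of \<open>R\<close>: fixing either
  argument turns the maximality into the equality case of the Cauchy--Schwarz inequality.
\<close>

lemma singular_pair_exists:
  fixes R :: "real ^ 'n2 ^ 'n1"
  assumes "R \<noteq> 0"
  obtains u v s where "norm u = 1" "norm v = 1" "s > 0" "R *v v = s *\<^sub>R u" "u v* R = s *\<^sub>R v"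
proof -
  let ?K = "cball (0 :: real ^ 'n1) 1 \<times> cball (0 :: real ^ 'n2) 1"
  have "continuous_on ?K (\<lambda>p. fst p \<bullet> (R *v snd p))"
    by (intro continuous_intros bounded_linear.continuous_on[OF matrix_vector_mul_bounded_linear])
  then obtain p where p: "p \<in> ?K" "\<And>q. q \<in> ?K \<Longrightarrow> fst q \<bullet> (R *v snd q) \<le> fst p \<bullet> (R *v snd p)"
    using continuous_attains_sup[of ?K "\<lambda>p. fst p \<bullet> (R *v snd p)"] by (auto simp: compact_Times)
  define u v where "u = fst p" and "v = snd p"
  define s where "s = u \<bullet> (R *v v)"
  have uv: "norm u \<le> 1" "norm v \<le> 1"
    using p(1) by (auto simp: u_def v_def)
  have max: "x \<bullet> (R *v y) \<le> s" if "norm x \<le> 1" "norm y \<le> 1" for x y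
    using p(2)[of "(x, y)"] that by (simp add: s_def u_def v_def)
  have "s > 0"
  proof -
    obtain y where y: "R *v y \<noteq> 0"
      using assms by (metis matrix_eq matrix_vector_mult_0)
    then have "y \<noteq> 0"
      by auto
    have "R *v sgn y = inverse (norm y) *\<^sub>R (R *v y)"
      by (simp add: sgn_div_norm matrix_vector_mult_scaleR)
    then have "sgn (R *v y) \<bullet> (R *v sgn y) = norm (R *v y) / norm y"
      by (simp add: inner_commute[of "sgn _"] inner_sgn_self divide_inverse_commute)
    moreover have "sgn (R *v y) \<bullet> (R *v sgn y) \<le> s"
      by (rule max) (simp_all add: norm_sgn)
    moreover have "0 < norm (R *v y) / norm y"
      using y \<open>y \<noteq> 0\<close> by simp
    ultimately show ?thesis
      by linarith
  qed
  \<comment> \<open>The equality case of the Cauchy--Schwarz inequality.\<close>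
  have eq: "z = s *\<^sub>R w" if "norm z \<le> s" "norm w \<le> 1" "w \<bullet> z = s" for z w :: "'b::real_inner"
  proof -
    have "(norm z)\<^sup>2 \<le> s\<^sup>2" "(norm w)\<^sup>2 \<le> 1"
      using that by (auto intro: power_mono simp: power_le_one)
    then have "(norm z)\<^sup>2 \<le> s\<^sup>2" "s\<^sup>2 * (norm w)\<^sup>2 \<le> s\<^sup>2"
      by (auto simp: mult_left_le)
    moreover have "(norm (z - s *\<^sub>R w))\<^sup>2 = (norm z)\<^sup>2 - 2 * s * (w \<bullet> z) + s\<^sup>2 * (norm w)\<^sup>2"
      unfolding power2_norm_eq_inner by (simp add: algebra_simps inner_commute power2_eq_square)
    ultimately have "(norm (z - s *\<^sub>R w))\<^sup>2 \<le> 0"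
      using that(3) by (simp add: power2_eq_square)
    then show ?thesis
      by simp
  qed
  have "norm (R *v v) \<le> s"
    using max[of "sgn (R *v v)" v] uv
    by (simp add: norm_sgn inner_commute[of "sgn _"] inner_sgn_self)
  then have Rv: "R *v v = s *\<^sub>R u"
    using uv by (intro eq) (auto simp: s_def)
  have "norm (u v* R) \<le> s"
    using max[of u "sgn (u v* R)"] uv
    by (simp add: norm_sgn inner_sgn_self dot_lmul_matrix[symmetric])
  then have uR: "u v* R = s *\<^sub>R v"
    using uv by (intro eq) (auto simp: s_def inner_commute dot_lmul_matrix[symmetric])
  have "s = u \<bullet> (R *v v)"
    by (simp add: s_def)
  then have "s = s * (u \<bullet> u)"
    by (simp add: Rv)
  moreover have "s = (u v* R) \<bullet> v"
    by (simp add: s_def dot_lmul_matrix)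
  then have "s = s * (v \<bullet> v)"
    by (simp add: uR)
  ultimately have "norm u = 1" "norm v = 1"
    using \<open>s > 0\<close> by (simp_all add: norm_eq_1)
  then show thesis
    using that \<open>s > 0\<close> Rv uR by blast
qed

text \<open>
  Take a family of singular pairs of maximal size; orthonormality bounds the size by the dimension.
  The matrix \<open>R\<close> that remains after subtracting the family annihilates it on both
  sides, so a singular pair of \<open>R\<close> would be orthogonal to the family and a singular
  pair of \<open>X\<close> itself, extending the family. Hence \<open>R = 0\<close>.
\<close>

lemma svd_exists:
  fixes X :: "real ^ 'n2 ^ 'n1"
  obtains r u s v where "orthonormal_family r u" "orthonormal_family r v" "\<And>k. k < r \<Longrightarrow> s k > 0"
    "X = usv_matrix r u s v"
proof -
  define good where "good n u s v \<longleftrightarrow> orthonormal_family n u \<and> orthonormal_family n v \<and>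
      (\<forall>k<n. s k > 0 \<and> X *v v k = s k *\<^sub>R u k \<and> u k v* X = s k *\<^sub>R v k)" for n u s v
  define attained where "attained n \<longleftrightarrow> (\<exists>u s v. good n u s v)" for n
  have "attained 0"
    by (simp add: attained_def good_def orthonormal_family_def)
  moreover have bound: "n \<le> CARD('n1)" if "attained n" for n
    using that orthonormal_family_le_card by (auto simp: attained_def good_def)
  ultimately have n: "attained (Greatest attained)"
    by (rule GreatestI_nat)
  define n where "n = Greatest attained"
  have max: "m \<le> n" if "attained m" for m
    unfolding n_def using that bound by (rule Greatest_le_nat)
  from n obtain u s v where g: "good n u s v"
    by (auto simp: attained_def n_def)
  then have ou: "orthonormal_family n u" and ov: "orthonormal_family n v"
    by (auto simp: good_def)
  define R where "R = X - usv_matrix n u s v"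
  have Rv: "R *v v k = 0" and uR: "u k v* R = 0" if "k < n" for k
    using g that
    by (simp_all add: R_def good_def matrix_vector_mult_diff_rdistrib vector_matrix_mult_diff_rdistrib
        usv_matrix_mult_right_singular[OF ov] usv_matrix_mult_left_singular[OF ou])
  have "R = 0"
  proof (rule ccontr)
    assume "R \<noteq> 0"
    then obtain x y t where xy: "norm x = 1" "norm y = 1" "t > 0" "R *v y = t *\<^sub>R x" "x v* R = t *\<^sub>R y"
      by (rule singular_pair_exists)
    have ux: "u k \<bullet> x = 0" if "k < n" for k
    proof -
      have "t * (u k \<bullet> x) = (u k v* R) \<bullet> y"
        using xy(4) by (simp add: dot_lmul_matrix)
      then show ?thesis
        using uR[OF that] xy(3) by simp
    qed
    have vy: "v k \<bullet> y = 0" if "k < n" for k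
    proof -
      have "t * (v k \<bullet> y) = (x v* R) \<bullet> v k"
        using xy(5) by (simp add: inner_commute)
      then show ?thesis
        using Rv[OF that] xy(3) by (simp add: dot_lmul_matrix)
    qed
    have "usv_matrix n u s v *v y = 0" "x v* usv_matrix n u s v = 0"
      by (simp_all add: usv_matrix_mult_vec vec_mult_usv_matrix ux vy)
    moreover have "X = R + usv_matrix n u s v"
      by (simp add: R_def)
    ultimately have "X *v y = t *\<^sub>R x" "x v* X = t *\<^sub>R y"
      using xy by (simp_all add: matrix_vector_mult_add_rdistrib vector_matrix_mult_add_rdistrib)
    then have "good (Suc n) (u(n := x)) (s(n := t)) (v(n := y))"
      using g xy orthonormal_family_Suc[OF ou xy(1) ux] orthonormal_family_Suc[OF ov xy(2) vy]
      by (auto simp: good_def less_Suc_eq)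
    then have "attained (Suc n)"
      unfolding attained_def by blast
    then have "Suc n \<le> n"
      by (rule max)
    then show False
      by simp
  qed
  then show thesis
    using g by (intro that[of n u v s]) (auto simp: R_def good_def)
qed

text \<open>
  The columns \<open>u k\<close> form a basis of the range. This ties the number of terms to
  \<open>rank X\<close>, which the definition of a reduced decomposition prescribes.
\<close>

lemma rank_usv_matrix:
  assumes ou: "orthonormal_family r u" and ov: "orthonormal_family r v" and s: "\<And>k. k < r \<Longrightarrow> s k > 0"
  shows "rank (usv_matrix r u s v) = r"
proof -
  let ?A = "usv_matrix r u s v"
  have "range ((*v) ?A) = span (u ` {..<r})"
  proof
    have "?A *v x \<in> span (u ` {..<r})" for x
      unfolding usv_matrix_mult_vec by (rule span_sum, rule span_scale, rule span_base) simp
    then show "range ((*v) ?A) \<subseteq> span (u ` {..<r})"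
      by blast
    have "u k \<in> range ((*v) ?A)" if "k < r" for k
    proof
      show "u k = ?A *v ((1 / s k) *\<^sub>R v k)"
        using s[OF that] by (simp add: matrix_vector_mult_scaleR usv_matrix_mult_right_singular[OF ov that])
    qed simp
    moreover have "subspace (range ((*v) ?A))"
      by (intro linear_subspace_image) auto
    ultimately show "span (u ` {..<r}) \<subseteq> range ((*v) ?A)"
      by (intro span_minimal) auto
  qed
  then show ?thesis
    using orthonormal_family_independent[OF ou]
    by (simp add: rank_dim_range dim_eq_card_independent card_image)
qed

lemma reduced_svd_exists: "\<exists>u s v. reduced_svd X u s v"
proof -
  obtain r u s v where "orthonormal_family r u" "orthonormal_family r v" "\<And>k. k < r \<Longrightarrow> s k > 0"
    "X = usv_matrix r u s v"
    using svd_exists[of X] by metis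
  then show ?thesis
    using rank_usv_matrix[of r u v s] unfolding reduced_svd_def by metis
qed

text \<open>
  Shrinkage may send singular values to 0, and the expression it yields is then no longer a reduced
  decomposition. Listing only the indices with a positive value restores one, with the same sum of
  values.
\<close>

lemma reduced_svd_of_nonneg:
  assumes ou: "orthonormal_family r u" and ov: "orthonormal_family r v" and s: "\<And>k. k < r \<Longrightarrow> 0 \<le> s k"
  obtains u' s' v' where "reduced_svd (usv_matrix r u s v) u' s' v'"
    "(\<Sum>k<rank (usv_matrix r u s v). s' k) = (\<Sum>k<r. s k)"
proof -
  define A where "A = {k. k < r \<and> s k > 0}"
  have "finite A" "A \<subseteq> {..<r}"
    by (auto simp: A_def)
  then obtain p where p: "bij_betw p {..<card A} A"
    using ex_bij_betw_nat_finite[of A] by (auto simp: atLeast0LessThan)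
  have pA: "p k \<in> A" if "k < card A" for k
    using p that by (auto simp: bij_betw_def)
  have reindex: "(\<Sum>k<card A. f (p k)) = (\<Sum>k<r. f k)" if "\<And>k. s k = 0 \<Longrightarrow> f k = 0" for f :: "nat \<Rightarrow> real"
  proof -
    have "(\<Sum>k<card A. f (p k)) = (\<Sum>k\<in>A. f k)"
      using p by (rule sum.reindex_bij_betw)
    also have "\<dots> = (\<Sum>k<r. f k)"
      using \<open>A \<subseteq> {..<r}\<close> s that by (intro sum.mono_neutral_left) (auto simp: A_def order.order_iff_strict)
    finally show ?thesis .
  qed
  have eq: "usv_matrix r u s v = usv_matrix (card A) (u \<circ> p) (s \<circ> p) (v \<circ> p)"
    by (simp add: usv_matrix_def vec_eq_iff reindex[where f="\<lambda>k. u k $ _ * s k * v k $ _"])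
  have o: "orthonormal_family (card A) (u \<circ> p)" "orthonormal_family (card A) (v \<circ> p)"
    using p \<open>A \<subseteq> {..<r}\<close> by (auto intro!: orthonormal_family_reindex ou ov simp: bij_betw_def)
  have pos: "(s \<circ> p) k > 0" if "k < card A" for k
    using pA[OF that] by (simp add: A_def)
  have rank: "rank (usv_matrix r u s v) = card A"
    unfolding eq using o pos by (rule rank_usv_matrix)
  show thesis
  proof (rule that)
    show "reduced_svd (usv_matrix r u s v) (u \<circ> p) (s \<circ> p) (v \<circ> p)"
      unfolding reduced_svd_def rank using o pos eq by simp
    show "(\<Sum>k<rank (usv_matrix r u s v). (s \<circ> p) k) = (\<Sum>k<r. s k)"
      unfolding rank by (simp add: reindex)
  qed
qed

section \<open>Nuclear norm and singular value shrinkage\<close>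

text \<open>
  The duality between the operator norm and the nuclear norm: the left factor has operator norm at
  most \<open>t\<close>, and pairing it with the right factor tests it on the unit vectors \<open>u'
  k\<close>, \<open>v' k\<close> with weights \<open>s k\<close>. The bound on the operator norm is
  Bessel's inequality for \<open>u\<close> and \<open>v\<close>.
\<close>

lemma trace_duality:
  assumes ou: "orthonormal_family r u" and ov: "orthonormal_family r v"
    and c: "\<And>k. k < r \<Longrightarrow> 0 \<le> c k" "\<And>k. k < r \<Longrightarrow> c k \<le> t"  and "0 \<le> t"
    and ou': "orthonormal_family m u'" and ov': "orthonormal_family m v'"
    and s: "\<And>k. k < m \<Longrightarrow> 0 \<le> s k"
  shows "usv_matrix r u c v \<bullet> usv_matrix m u' s v' \<le> t * (\<Sum>k<m. s k)"
proof -
  have contraction: "y \<bullet> (usv_matrix r u c v *v x) \<le> t" if "norm x = 1" "norm y = 1" for x y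
  proof -
    have "y \<bullet> (usv_matrix r u c v *v x) = (\<Sum>k<r. c k * ((v k \<bullet> x) * (u k \<bullet> y)))"
      by (simp add: usv_matrix_mult_vec inner_sum_right inner_commute mult_ac)
    also have "\<dots> \<le> (\<Sum>k<r. t * (((v k \<bullet> x)\<^sup>2 + (u k \<bullet> y)\<^sup>2) / 2))"
    proof (rule sum_mono)
      fix k assume "k \<in> {..<r}"
      then have k: "0 \<le> c k" "c k \<le> t"
        using c by auto
      have "(v k \<bullet> x) * (u k \<bullet> y) \<le> ((v k \<bullet> x)\<^sup>2 + (u k \<bullet> y)\<^sup>2) / 2"
        using sum_squares_bound[of "v k \<bullet> x" "u k \<bullet> y"] by simp
      then show "c k * ((v k \<bullet> x) * (u k \<bullet> y)) \<le> t * (((v k \<bullet> x)\<^sup>2 + (u k \<bullet> y)\<^sup>2) / 2)"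
        using k by (meson mult_left_mono mult_right_mono order_trans divide_nonneg_nonneg
            sum_power2_ge_zero zero_le_numeral)
    qed
    also have "\<dots> = t * (((\<Sum>k<r. (v k \<bullet> x)\<^sup>2) + (\<Sum>k<r. (u k \<bullet> y)\<^sup>2)) / 2)"
      by (simp add: sum_distrib_left sum_divide_distrib sum.distrib[symmetric])
    also have "\<dots> \<le> t * 1"
      using bessel_inequality[OF ov, of x] bessel_inequality[OF ou, of y] that \<open>0 \<le> t\<close>
      by (intro mult_left_mono) auto
    finally show ?thesis
      by simp
  qed
  have "norm (u' k) = 1" "norm (v' k) = 1" if "k < m" for k
    using ou' ov' that by (auto simp: orthonormal_family_def norm_eq_1)
  then have "usv_matrix r u c v \<bullet> usv_matrix m u' s v' \<le> (\<Sum>k<m. s k * t)"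
    unfolding inner_usv_matrix using s contraction by (intro sum_mono mult_left_mono) auto
  then show ?thesis
    by (simp add: sum_distrib_left mult.commute)
qed

text \<open>
  Replacing all singular values by 1 in one decomposition gives a contraction whose pairing with
  \<open>X\<close> is the sum of the singular values of that decomposition; by
  \<open>trace_duality\<close> the sum of any other decomposition is at least as large. Hence all
  sums agree and the definite description is proper.
\<close>

lemma nuclear_norm_eq:
  assumes "reduced_svd X u s v"
  shows "nuclear_norm X = (\<Sum>k<rank X. s k)"
proof -
  have le: "(\<Sum>k<rank X. s k) \<le> (\<Sum>k<rank X. s' k)"
    if "reduced_svd X u s v" "reduced_svd X u' s' v'" for u s v u' s' v'
  proof -
    have X: "X = usv_matrix (rank X) u s v" "X = usv_matrix (rank X) u' s' v'"
      and o: "orthonormal_family (rank X) u" "orthonormal_family (rank X) v"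
        "orthonormal_family (rank X) u'" "orthonormal_family (rank X) v'"
      and s': "\<And>k. k < rank X \<Longrightarrow> 0 \<le> s' k"
      using that by (auto simp: reduced_svd_def intro: less_imp_le)
    have "(\<Sum>k<rank X. s k) = usv_matrix (rank X) u (\<lambda>_. 1) v \<bullet> X"
      by (subst (3) X(1)) (simp add: inner_usv_matrix_same[OF o(1,2)])
    also have "\<dots> \<le> 1 * (\<Sum>k<rank X. s' k)"
      by (subst (2) X(2), rule trace_duality) (use o s' in auto)
    finally show ?thesis
      by simp
  qed
  show ?thesis
    unfolding nuclear_norm_def
    by (rule the_equality) (use assms le in \<open>blast intro: antisym\<close>)+
qed

lemma nuclear_norm_usv_matrix:
  assumes "orthonormal_family r u" "orthonormal_family r v" "\<And>k. k < r \<Longrightarrow> 0 \<le> s k"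
  shows "nuclear_norm (usv_matrix r u s v) = (\<Sum>k<r. s k)"
proof -
  obtain u' s' v' where "reduced_svd (usv_matrix r u s v) u' s' v'"
    "(\<Sum>k<rank (usv_matrix r u s v). s' k) = (\<Sum>k<r. s k)"
    using assms by (rule reduced_svd_of_nonneg)
  then show ?thesis
    by (simp add: nuclear_norm_eq)
qed

text \<open>
  Any bound on bounded sets serves the coercivity of the dual; the number of singular values times
  the largest of them is the easiest.
\<close>

lemma nuclear_norm_le_norm:
  fixes X :: "real ^ 'n2 ^ 'n1"
  shows "nuclear_norm X \<le> real CARD('n1) * norm X"
proof -
  obtain u s v where svd: "reduced_svd X u s v"
    using reduced_svd_exists by blast
  then have X: "X = usv_matrix (rank X) u s v" and o: "orthonormal_family (rank X) u" "orthonormal_family (rank X) v"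
    by (auto simp: reduced_svd_def)
  have "s k \<le> norm X" if "k < rank X" for k
  proof -
    have "(s k)\<^sup>2 \<le> (\<Sum>l<rank X. s l * s l)"
      unfolding power2_eq_square using that by (intro member_le_sum) auto
    also have "\<dots> = usv_matrix (rank X) u s v \<bullet> usv_matrix (rank X) u s v"
      by (simp add: inner_usv_matrix_same[OF o])
    also have "\<dots> = (norm X)\<^sup>2"
      unfolding power2_norm_eq_inner using X by simp
    finally show ?thesis
      by (rule power2_le_imp_le) simp
  qed
  then have "(\<Sum>k<rank X. s k) \<le> (\<Sum>k<rank X. norm X)"
    by (intro sum_mono) auto
  also have "\<dots> \<le> real CARD('n1) * norm X"
    using orthonormal_family_le_card[OF o(1)] by (simp add: mult_right_mono)
  finally show ?thesis
    using nuclear_norm_eq[OF svd] by simp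
qed

text \<open>
  The residual \<open>Y - Z\<close> has singular values \<open>min \<tau> (s k)\<close>, so
  \<open>trace_duality\<close> bounds its pairing with \<open>W\<close>. Its pairing with
  \<open>Z\<close> attains the bound, because \<open>s k > \<tau>\<close> wherever \<open>Z\<close>
  has a nonzero singular value. The inequality is stated for one chosen decomposition, since it is
  what shows that \<open>sv_shrink\<close> is well defined.
\<close>

lemma shrunk_svd_prox_inequality:
  fixes Y W :: "real ^ 'n2 ^ 'n1"
  assumes svd: "reduced_svd Y u s v" and "0 < \<tau>"
  defines "Z \<equiv> usv_matrix (rank Y) u (\<lambda>k. max 0 (s k - \<tau>)) v"
  shows "\<tau> * nuclear_norm Z + (Y - Z) \<bullet> (W - Z) \<le> \<tau> * nuclear_norm W"
proof -
  have Y: "Y = usv_matrix (rank Y) u s v" and o: "orthonormal_family (rank Y) u" "orthonormal_family (rank Y) v"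
    and s: "\<And>k. k < rank Y \<Longrightarrow> 0 < s k"
    using svd by (auto simp: reduced_svd_def)
  \<comment> \<open>\<open>t - max 0 (t - \<tau>) = min \<tau> t\<close> for every singular value \<open>t\<close>.\<close>
  have residual: "Y - Z = usv_matrix (rank Y) u (\<lambda>k. min \<tau> (s k)) v"
    unfolding Z_def
    by (subst (1) Y)
       (auto simp: usv_matrix_def vec_eq_iff sum_subtractf[symmetric] left_diff_distrib[symmetric]
         right_diff_distrib[symmetric] intro!: sum.cong)
  have Z: "nuclear_norm Z = (\<Sum>k<rank Y. max 0 (s k - \<tau>))"
    unfolding Z_def by (rule nuclear_norm_usv_matrix[OF o]) auto
  have "(Y - Z) \<bullet> Z = (\<Sum>k<rank Y. min \<tau> (s k) * max 0 (s k - \<tau>))"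
    unfolding residual unfolding Z_def by (rule inner_usv_matrix_same[OF o])
  also have "\<dots> = (\<Sum>k<rank Y. \<tau> * max 0 (s k - \<tau>))"
    by (intro sum.cong) (auto simp: max_def min_def)
  finally have 1: "(Y - Z) \<bullet> Z = \<tau> * nuclear_norm Z"
    by (simp add: Z sum_distrib_left)
  obtain u' s' v' where W: "reduced_svd W u' s' v'"
    using reduced_svd_exists by blast
  then have "usv_matrix (rank Y) u (\<lambda>k. min \<tau> (s k)) v \<bullet> usv_matrix (rank W) u' s' v' \<le> \<tau> * (\<Sum>k<rank W. s' k)"
    using s \<open>0 < \<tau>\<close> by (intro trace_duality o) (auto simp: reduced_svd_def less_imp_le)
  moreover have "usv_matrix (rank W) u' s' v' = W"
    using W by (simp add: reduced_svd_def)
  ultimately have 2: "(Y - Z) \<bullet> W \<le> \<tau> * nuclear_norm W"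
    by (simp add: residual nuclear_norm_eq[OF W])
  show ?thesis
    using 1 2 by (simp add: inner_diff_right)
qed

text \<open>
  Two shrunk matrices from different decompositions both satisfy the subgradient inequality for the
  same \<open>Y\<close>; testing each against the other bounds the squared norm of their difference
  by 0.
\<close>

lemma sv_shrink_eq:
  assumes svd: "reduced_svd Y u s v" and "0 < \<tau>"
  shows "sv_shrink \<tau> Y = usv_matrix (rank Y) u (\<lambda>k. max 0 (s k - \<tau>)) v"
  unfolding sv_shrink_def
proof (rule the_equality)
  let ?Z = "usv_matrix (rank Y) u (\<lambda>k. max 0 (s k - \<tau>)) v"
  fix Z' assume "\<exists>u s v. reduced_svd Y u s v \<and> Z' = usv_matrix (rank Y) u (\<lambda>k. max 0 (s k - \<tau>)) v"
  then have "\<tau> * nuclear_norm Z' + (Y - Z') \<bullet> (?Z - Z') \<le> \<tau> * nuclear_norm ?Z"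
    using shrunk_svd_prox_inequality \<open>0 < \<tau>\<close> by blast
  with shrunk_svd_prox_inequality[OF assms, of Z'] have "(Z' - ?Z) \<bullet> (Z' - ?Z) \<le> 0"
    by (simp add: algebra_simps inner_commute)
  then show "Z' = ?Z"
    by (simp flip: power2_norm_eq_inner)
qed (use svd in blast)

lemma sv_shrink_is_prox:
  assumes "0 < \<tau>"
  shows "is_prox (\<lambda>W. \<tau> * nuclear_norm W) (sv_shrink \<tau>)"
  unfolding is_prox_def
  using reduced_svd_exists shrunk_svd_prox_inequality[OF _ assms] sv_shrink_eq[OF _ assms] by metis

lemma orthogonal_projection_proj_on: "orthogonal_projection (proj_on \<Omega>)"
  unfolding orthogonal_projection_def
proof (intro conjI allI)
  show "linear (proj_on \<Omega>)"
    by (rule linearI) (auto simp: proj_on_def vec_eq_iff)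
  show "proj_on \<Omega> (proj_on \<Omega> x) = proj_on \<Omega> x" for x
    by (auto simp: proj_on_def vec_eq_iff)
  show "proj_on \<Omega> x \<bullet> y = x \<bullet> proj_on \<Omega> y" for x y
    by (auto simp: proj_on_def inner_vec_def intro!: sum.cong)
qed

theorem theorem4p2:
  fixes M :: "real ^ 'n2 ^ 'n1"
    and \<Omega> :: "('n1 \<times> 'n2) set"
    and \<tau> :: real
    and \<delta> :: "nat \<Rightarrow> real"
    and X Y :: "nat \<Rightarrow> real ^ 'n2 ^ 'n1"
  assumes "\<tau> > 0"
    and "0 < (INF k\<in>{1..}. ereal (\<delta> k))"
    and "(SUP k\<in>{1..}. ereal (\<delta> k)) < 2"
    and "Y 0 = 0"
    and "\<forall>k\<ge>1. X k = sv_shrink \<tau> (Y (k - 1))"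
    and "\<forall>k\<ge>1. Y k = Y (k - 1) + \<delta> k *\<^sub>R proj_on \<Omega> (M - X k)"
  shows "\<exists>Z. is_arg_min (\<lambda>W. \<tau> * nuclear_norm W + 1 / 2 * (norm W)\<^sup>2)
                        (\<lambda>W. proj_on \<Omega> W = proj_on \<Omega> M) Z
           \<and> (\<forall>Z'. is_arg_min (\<lambda>W. \<tau> * nuclear_norm W + 1 / 2 * (norm W)\<^sup>2)
                              (\<lambda>W. proj_on \<Omega> W = proj_on \<Omega> M) Z' \<longrightarrow> Z' = Z)
           \<and> X \<longlonglongrightarrow> Z"
proof -
  have prox: "is_prox (\<lambda>W :: real ^ 'n2 ^ 'n1. \<tau> * nuclear_norm W) (sv_shrink \<tau>)"
    using assms(1) by (rule sv_shrink_is_prox)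
  note P = orthogonal_projection_proj_on[of \<Omega>]
  have bdd: "\<tau> * nuclear_norm W \<le> \<tau> * (real CARD('n1) * (norm M + 1))"
    if "norm (W - M) \<le> 1" for W :: "real ^ 'n2 ^ 'n1"
  proof -
    have "norm W \<le> norm M + 1"
      using that norm_triangle_ineq[of M "W - M"] by simp
    then have "nuclear_norm W \<le> real CARD('n1) * (norm M + 1)"
      by (intro order_trans[OF nuclear_norm_le_norm] mult_left_mono) auto
    with \<open>\<tau> > 0\<close> show ?thesis
      by simp
  qed
  obtain Ystar where Ystar: "proj_on \<Omega> Ystar = Ystar" "proj_on \<Omega> (sv_shrink \<tau> Ystar) = proj_on \<Omega> M"
    using dual_minimizer_exists[OF prox P bdd] dual_minimizer_feasible[OF prox P] by metis
  note min = saddle_point_unique_minimizer[OF prox P Ystar]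
  obtain a where a: "0 < ereal a" "ereal a < (INF k\<in>{1..}. ereal (\<delta> k))"
    using ereal_dense2[OF assms(2)] by blast
  obtain b where b: "(SUP k\<in>{1..}. ereal (\<delta> k)) < ereal b" "ereal b < 2"
    using ereal_dense2[OF assms(3)] by blast
  have da: "a \<le> \<delta> k" and db: "\<delta> k \<le> b" if "k \<ge> 1" for k
  proof -
    have "ereal a < ereal (\<delta> k)"
      using a(2) that by (meson INF_lower atLeast_iff order_less_le_trans)
    then show "a \<le> \<delta> k"
      by simp
    have "ereal (\<delta> k) < ereal b"
      using b(1) that by (meson SUP_upper atLeast_iff order_le_less_trans)
    then show "\<delta> k \<le> b"
      by simp
  qed
  have ab: "0 < a" "b < 2"
    using a(1) b(2) by simp_all
  have "X \<longlonglongrightarrow> sv_shrink \<tau> Ystar"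
    by (rule uzawa_convergence[OF prox P Ystar ab da db]) (use assms(4-6) in auto)
  moreover have "is_arg_min (\<lambda>W. \<tau> * nuclear_norm W + 1 / 2 * (norm W)\<^sup>2)
      (\<lambda>W. proj_on \<Omega> W = proj_on \<Omega> M) (sv_shrink \<tau> Ystar)"
    unfolding is_arg_min_def using Ystar(2) min by (metis less_asym less_irrefl)
  moreover have "Z' = sv_shrink \<tau> Ystar"
    if "is_arg_min (\<lambda>W. \<tau> * nuclear_norm W + 1 / 2 * (norm W)\<^sup>2)
      (\<lambda>W. proj_on \<Omega> W = proj_on \<Omega> M) Z'" for Z'
    using that Ystar(2) min[of Z'] unfolding is_arg_min_def by blast
  ultimately show ?thesis
    by blast
qed

end
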